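(* For every $\rho\ge1$ and every dimension $d$ there exists a function $\beta\colon(0,1]\to(0,1)$ with the following property. Let $0\le k\le d$ be an integer, $\alpha\in(0,1]$, and let $\mathcal{F}_1,\ldots,\mathcal{F}_{k+2}$ be finite nonempty families of $\rho$-fat convex sets in $\mathbb{R}^d$. If at least $\alpha|\mathcal{F}_1|\cdots|\mathcal{F}_{k+2}|$ of the colorful selections have a $k$-transversal, then there exists an index $i$ such that $\mathcal{F}_i$ has a subfamily of size at least $\beta(\alpha)|\mathcal{F}_i|$ which has a $k$-transversal.
   Context: A colorful selection is a tuple $(K_1,\ldots,K_{k+2})$ with $K_j\in\mathcal{F}_j$ for each $j$. A $k$-flat is a $k$-dimensional affine subspace of $\mathbb{R}^d$; a family has a $k$-transversal if a single $k$-flat intersects all its members. A family $\mathcal{F}$ of sets in $\mathbb{R}^d$ is $\rho$-fat if for every $K\in\mathcal{F}$ there exist $x_K\in\mathbb{R}^d$ and reals $0<r_K\le R_K\le \rho r_K$ with $B(x_K,r_K)\subseteq K\subseteq B(x_K,R_K)$, $B(x,r)$ denoting the closed Euclidean ball. *)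

theory Defs
  imports "HOL-Analysis.Analysis"
begin

definition flat :: "nat \<Rightarrow> (real ^ 'n) set \<Rightarrow> bool" where
  "flat k T \<longleftrightarrow> affine T \<and> aff_dim T = int k"

definition has_transversal :: "nat \<Rightarrow> (real ^ 'n) set set \<Rightarrow> bool" where
  "has_transversal k \<F> \<longleftrightarrow> (\<exists>T. flat k T \<and> (\<forall>K\<in>\<F>. K \<inter> T \<noteq> {}))"

definition fat_family :: "real \<Rightarrow> (real ^ 'n) set set \<Rightarrow> bool" where
  "fat_family \<rho> \<F> \<longleftrightarrow>
    (\<forall>K\<in>\<F>. \<exists>x r R. 0 < r \<and> r \<le> R \<and> R \<le> \<rho> * r \<and> cball x r \<subseteq> K \<and> K \<subseteq> cball x R)"

text \<open>
  A tuple \<open>(K\<^sub>1, \<dots>, K\<^sub>m)\<close> is encoded as an extensional function on \<open>{1..m}\<close>, so that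
  the number of colorful selections is the product of the sizes of the families.
  The families need not be disjoint, and the entries of a tuple may coincide.
\<close>

definition colorful_selections ::
    "nat \<Rightarrow> (nat \<Rightarrow> (real ^ 'n) set set) \<Rightarrow> (nat \<Rightarrow> (real ^ 'n) set) set" where
  "colorful_selections m \<F> = (\<Pi>\<^sub>E j\<in>{1..m}. \<F> j)"

end

theory Submission
  imports Defs
begin

text \<open>
  Let the sets \<open>K\<^sub>i \<supseteq> B(x\<^sub>i, r\<^sub>i)\<close> of a colorful selection meet a common \<open>k\<close>-flat in points \<open>p\<^sub>i\<close>.
  These \<open>k + 2\<close> points satisfy a nontrivial relation \<open>\<Sum> c\<^sub>i p\<^sub>i = 0\<close>, \<open>\<Sum> c\<^sub>i = 0\<close>. Choose \<open>i\<close> maximising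
  \<open>\<bar>c\<^sub>i\<bar> r\<^sub>i\<close> and write \<open>p\<^sub>i\<close> as an affine combination of the other \<open>p\<^sub>j\<close>: moving each \<open>p\<^sub>j\<close> by
  at most \<open>\<epsilon> r\<^sub>j\<close> moves the combination by only \<open>O(\<epsilon> r\<^sub>i)\<close>. So the \<open>p\<^sub>j\<close> may be replaced by points
  \<open>x\<^sub>j + r\<^sub>j e\<^sub>j\<close> with \<open>e\<^sub>j\<close> in a fixed finite net, and the affine hull of these still hits \<open>K\<^sub>i\<close>.
  Thus some \<open>K\<^sub>i\<close> is hit by one of boundedly many flats determined by the other sets, and the
  theorem follows by the pigeonhole principle.
\<close>

section \<open>Flats and affine dependences\<close>

lemma affine_superset_of_dim:
  fixes S :: "'a::euclidean_space set"
  assumes "aff_dim S \<le> int k" "k \<le> DIM('a)"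
  shows "\<exists>T. affine T \<and> aff_dim T = int k \<and> S \<subseteq> T"
  using assms
proof (induction "nat (int k - aff_dim S)" arbitrary: S)
  case 0
  then have "aff_dim (affine hull S) = int k" by simp
  then show ?case
    by (meson affine_affine_hull hull_subset)
next
  case (Suc m)
  then have lt: "aff_dim S < int k" by linarith
  then have "affine hull S \<noteq> UNIV"
    using Suc.prems(2) by (metis aff_dim_UNIV aff_dim_affine_hull linorder_not_less of_nat_le_iff)
  then obtain a where a: "a \<notin> affine hull S" by blast
  then have "aff_dim (insert a S) = aff_dim S + 1"
    by (simp add: aff_dim_insert)
  then have "m = nat (int k - aff_dim (insert a S))" "aff_dim (insert a S) \<le> int k"
    using Suc.hyps(2) lt by linarith+
  from Suc.hyps(1)[OF this Suc.prems(2)]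
  obtain T where "affine T" "aff_dim T = int k" "insert a S \<subseteq> T"
    by blast
  then show ?case by blast
qed

text \<open>\<open>q\<close> may repeat points, so the coefficients of coinciding points are added
  up in \<open>U\<close> before the description of affine sets by sums over sets of points
  applies.\<close>

lemma affine_sum_mem:
  fixes q :: "'i \<Rightarrow> 'a::real_vector"
  assumes "affine T" "finite J" "sum u J = (1::real)" "\<And>j. j \<in> J \<Longrightarrow> q j \<in> T"
  shows "(\<Sum>j\<in>J. u j *\<^sub>R q j) \<in> T"
proof -
  define U where "U y = sum u {j \<in> J. q j = y}" for y
  have "(\<Sum>y\<in>q ` J. U y *\<^sub>R y) = (\<Sum>y\<in>q ` J. \<Sum>j\<in>{j \<in> J. q j = y}. u j *\<^sub>R q j)"
    by (auto simp: U_def scaleR_sum_left intro!: sum.cong)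
  also have "\<dots> = (\<Sum>j\<in>J. u j *\<^sub>R q j)"
    using assms(2) by (simp add: sum.image_gen[of J _ q])
  finally have "(\<Sum>y\<in>q ` J. U y *\<^sub>R y) = (\<Sum>j\<in>J. u j *\<^sub>R q j)" .
  moreover have "sum U (q ` J) = 1"
    using assms(2,3) by (simp add: U_def sum.image_gen[of J u q])
  ultimately show ?thesis
    using assms affine[of T] by (metis finite_imageI image_subsetI sum.empty zero_neq_one)
qed

text \<open>The points are indexed because different entries of a selection may meet the flat in the
  same point. For injective \<open>p\<close> the dimension count gives the relation; otherwise two
  equal points with coefficients 1 and -1 do.\<close>

lemma indexed_affine_dependence:
  fixes p :: "'i \<Rightarrow> 'a::euclidean_space"
  assumes "finite I" "aff_dim T + 1 < int (card I)" "p ` I \<subseteq> T"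
  shows "\<exists>c::'i \<Rightarrow> real. sum c I = 0 \<and> (\<Sum>i\<in>I. c i *\<^sub>R p i) = 0 \<and> (\<exists>i\<in>I. c i \<noteq> 0)"
proof (cases "inj_on p I")
  case True
  have "affine_dependent (p ` I)"
  proof (rule ccontr)
    assume "\<not> ?thesis"
    then have "aff_dim (p ` I) = int (card I) - 1"
      using aff_dim_affine_independent[of "p ` I"] card_image[OF True] by simp
    then show False
      using assms aff_dim_subset[of "p ` I" T] by linarith
  qed
  then obtain U where U: "sum U (p ` I) = 0" "\<exists>v\<in>p ` I. U v \<noteq> 0"
    "(\<Sum>v\<in>p ` I. U v *\<^sub>R v) = 0"
    using assms(1) affine_dependent_explicit_finite[of "p ` I"] by auto
  then show ?thesis
    using True by (intro exI[of _ "U \<circ> p"]) (auto simp: sum.reindex)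
next
  case False
  then obtain a b where ab: "a \<in> I" "b \<in> I" "a \<noteq> b" "p a = p b"
    by (auto simp: inj_on_def)
  define c where "c i = (if i = a then 1 else 0) - (if i = b then 1 else (0::real))" for i
  have "sum c I = 0"
    using ab assms(1) by (simp add: c_def sum_subtractf)
  moreover have "(\<Sum>i\<in>I. c i *\<^sub>R p i) = 0"
    using ab assms(1)
    by (simp add: c_def scaleR_left_diff_distrib sum_subtractf if_distrib[of "\<lambda>t. t *\<^sub>R _"] cong: if_cong)
  moreover have "c a \<noteq> 0" using ab by (simp add: c_def)
  ultimately show ?thesis using ab(1) by blast
qed

section \<open>Replacing the points of a transversal by net points\<close>

lemma hit_by_affine_hull_of_net_points:
  fixes p x :: "'i \<Rightarrow> 'a::euclidean_space"
  assumes fin: "finite I"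
    and c: "sum c I = 0" "(\<Sum>i\<in>I. c i *\<^sub>R p i) = 0" "\<exists>i\<in>I. c i \<noteq> (0::real)"
    and K: "\<And>i. i \<in> I \<Longrightarrow> 0 < r i \<and> cball (x i) (r i) \<subseteq> K i \<and> K i \<subseteq> cball (x i) (\<rho> * r i)
              \<and> convex (K i) \<and> p i \<in> K i"
    and net: "cball 0 (2 * \<rho>) \<subseteq> (\<Union>e\<in>E. cball e \<epsilon>)"
    and "1 \<le> \<rho>" "0 < \<epsilon>" "real (card I) * \<epsilon> * \<rho> \<le> 1"
  shows "\<exists>i\<in>I. \<exists>e\<in>I \<rightarrow>\<^sub>E E. K i \<inter> affine hull ((\<lambda>j. x j + r j *\<^sub>R e j) ` (I - {i})) \<noteq> {}"
proof -
  \<comment> \<open>\<open>w i\<close> measures the effect on the relation of moving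
    \<open>p i\<close> by its own radius. Solving for the point with the largest \<open>w\<close>
    makes each other point contribute at most \<open>r i\<close>.\<close>
  define w where "w i = \<bar>c i\<bar> * r i" for i
  have rpos: "0 < r i" if "i \<in> I" for i using K that by blast
  have xp: "norm (x i - p i) \<le> \<rho> * r i" if "i \<in> I" for i
    using K[OF that] by (auto simp: dist_norm)
  have "I \<noteq> {}" using c(3) by auto
  then obtain i where "i \<in> I" "Max (w ` I) = w i"
    using obtains_MAX[OF fin] by blast
  then have i: "i \<in> I" "\<And>j. j \<in> I \<Longrightarrow> w j \<le> w i"
    using Max_ge[of "w ` I"] fin by auto
  have ci: "c i \<noteq> 0"
  proof
    assume "c i = 0"
    then have "w j \<le> 0" if "j \<in> I" for j using i(2)[OF that] by (simp add: w_def)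
    then have "c j = 0" if "j \<in> I" for j
      using that rpos[OF that] by (force simp: w_def mult_le_0_iff)
    then show False using c(3) by blast
  qed
  define J where "J = I - {i}"
  have J: "finite J" "J \<subseteq> I" "I = insert i J" "i \<notin> J" using fin i(1) by (auto simp: J_def)
  define \<mu> where "\<mu> j = - c j / c i" for j
  have \<mu>1: "sum \<mu> J = 1"
  proof -
    have "sum c J = - c i" using c(1) J by simp
    then have "sum \<mu> J = - (- c i) / c i"
      by (simp add: \<mu>_def sum_divide_distrib[symmetric] sum_negf)
    then show ?thesis using ci by simp
  qed
  have \<mu>p: "(\<Sum>j\<in>J. \<mu> j *\<^sub>R p j) = p i"
  proof -
    have *: "(\<Sum>j\<in>J. c j *\<^sub>R p j) = - (c i *\<^sub>R p i)"
      using c(2) J by (simp add: eq_neg_iff_add_eq_0 add.commute)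
    have "(\<Sum>j\<in>J. \<mu> j *\<^sub>R p j) = (- 1 / c i) *\<^sub>R (\<Sum>j\<in>J. c j *\<^sub>R p j)"
      by (simp add: \<mu>_def scaleR_sum_right)
    then show ?thesis using ci by (simp add: *)
  qed
  have "J \<noteq> {}" using \<mu>1 by auto
  \<comment> \<open>Among the remaining points, \<open>m\<close> has the largest influence:
    \<open>v m\<close> controls every single error, and \<open>p m\<close> is the point that needs
    the smallest shift in units of its own radius.\<close>
  define v where "v j = \<bar>\<mu> j\<bar> * r j" for j
  obtain m where "m \<in> J" "Max (v ` J) = v m"
    using obtains_MAX[OF J(1) \<open>J \<noteq> {}\<close>] by blast
  then have m: "m \<in> J" "\<And>j. j \<in> J \<Longrightarrow> v j \<le> v m"
    using Max_ge[of "v ` J"] J(1) by auto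
  have \<mu>m: "\<mu> m \<noteq> 0"
  proof
    assume "\<mu> m = 0"
    then have "v j \<le> 0" if "j \<in> J" for j using m(2)[OF that] by (simp add: v_def)
    then have "\<mu> j = 0" if "j \<in> J" for j
      using that rpos[of j] J(2) by (force simp: v_def mult_le_0_iff)
    then show False using \<mu>1 by simp
  qed
  have vm: "0 < v m" "v m \<le> r i"
  proof -
    show "0 < v m" using \<mu>m rpos m(1) J(2) by (auto simp: v_def)
    have "v m = w m / \<bar>c i\<bar>" by (simp add: v_def w_def \<mu>_def)
    also have "\<dots> \<le> w i / \<bar>c i\<bar>" using i(2) m(1) J(2) by (intro divide_right_mono) auto
    also have "\<dots> = r i" using ci by (simp add: w_def)
    finally show "v m \<le> r i" .
  qed
  define N where "N = real (card I) * \<epsilon>"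
  have N: "0 < N" "N * \<rho> \<le> 1"
    using assms(8,9) fin \<open>I \<noteq> {}\<close> by (auto simp: N_def card_gt_0_iff)
  have "N * 1 \<le> N * \<rho>" using N \<open>1 \<le> \<rho>\<close> by (intro mult_left_mono) auto
  then have "N \<le> 1" using N(2) by linarith
  have ri: "0 < r i" using rpos i(1) .
  \<comment> \<open>The perturbation errors add up to at most \<open>N * v m\<close>. Aiming at \<open>p i + u\<close> instead of \<open>p i\<close>
    leaves room for this error inside \<open>K i\<close>, and moving \<open>p m\<close> alone, by at most \<open>r m\<close>,
    suffices to hit the new target.\<close>
  define t where "t = N * v m / r i"
  have t: "0 < t" "t \<le> 1" "t * r i = N * v m"
  proof -
    show "0 < t" using N vm ri by (simp add: t_def)
    have "N * v m \<le> 1 * r i" using N vm \<open>N \<le> 1\<close> by (intro mult_mono) auto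
    then show "t \<le> 1" using ri by (simp add: t_def)
    show "t * r i = N * v m" using ri by (simp add: t_def)
  qed
  define u where "u = t *\<^sub>R (x i - p i)"
  define p' where "p' j = p j + (if j = m then (1 / \<mu> m) *\<^sub>R u else 0)" for j
  have p'sum: "(\<Sum>j\<in>J. \<mu> j *\<^sub>R p' j) = p i + u"
    using J(1) m(1) \<mu>m
    by (simp add: p'_def scaleR_add_right sum.distrib \<mu>p if_distrib[of "\<lambda>y. _ *\<^sub>R y"] cong: if_cong)
  \<comment> \<open>The bound on \<open>card I * \<epsilon> * \<rho>\<close> is made for this
    estimate: it lets \<open>v m\<close> absorb the factor \<open>\<rho>\<close> lost in the
    distance from \<open>p i\<close> to the centre \<open>x i\<close>.\<close>
  have shift: "norm ((1 / \<mu> m) *\<^sub>R u) \<le> r m"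
  proof -
    have "norm u \<le> t * (\<rho> * r i)" using xp[OF i(1)] t by (simp add: u_def mult_left_mono)
    also have "\<dots> = (N * \<rho>) * v m" using t(3) by (simp add: algebra_simps)
    also have "\<dots> \<le> 1 * v m" using N vm by (intro mult_right_mono) auto
    finally have "norm u \<le> \<bar>\<mu> m\<bar> * r m" by (simp add: v_def)
    then show ?thesis using \<mu>m by (simp add: divide_le_eq mult.commute)
  qed
  \<comment> \<open>In units of \<open>r j\<close>, the point \<open>p' j\<close> is within
    \<open>\<rho> + 1 \<le> 2 * \<rho>\<close> of \<open>x j\<close>; hence the radius of the ball
    covered by the net.\<close>
  have near: "\<exists>e\<in>E. norm (x j + r j *\<^sub>R e - p' j) \<le> \<epsilon> * r j" if "j \<in> I" for j
  proof -
    have rj: "0 < r j" using rpos that .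
    have "norm (p' j - x j) \<le> norm (x j - p j) + norm (if j = m then (1 / \<mu> m) *\<^sub>R u else 0)"
      unfolding p'_def by (metis add_diff_eq add.commute norm_minus_commute norm_triangle_ineq)
    also have "\<dots> \<le> \<rho> * r j + r j" using xp[OF that] shift rj by (auto intro: add_mono)
    also have "\<dots> \<le> 2 * \<rho> * r j" using \<open>1 \<le> \<rho>\<close> rj by simp
    finally have "(1 / r j) *\<^sub>R (p' j - x j) \<in> cball 0 (2 * \<rho>)"
      using rj by (simp add: divide_le_eq)
    then obtain e where e: "e \<in> E" "norm (e - (1 / r j) *\<^sub>R (p' j - x j)) \<le> \<epsilon>"
      using net by (fastforce simp: dist_norm)
    have "x j + r j *\<^sub>R e - p' j = r j *\<^sub>R (e - (1 / r j) *\<^sub>R (p' j - x j))"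
      using rj by (simp add: scaleR_diff_right)
    then have "norm (x j + r j *\<^sub>R e - p' j) \<le> \<epsilon> * r j"
      using e(2) rj by (simp add: mult.commute mult_left_mono)
    then show ?thesis using e(1) by blast
  qed
  then obtain e0 where e0: "\<And>j. j \<in> I \<Longrightarrow> e0 j \<in> E \<and> norm (x j + r j *\<^sub>R e0 j - p' j) \<le> \<epsilon> * r j"
    by metis
  \<comment> \<open>\<open>e\<close> also gets a value at \<open>i\<close>, which the hull ignores;
    so it ranges over a finite set that does not depend on \<open>i\<close>.\<close>
  define e where "e = restrict e0 I"
  define q where "q j = x j + r j *\<^sub>R e j" for j
  have e: "e \<in> I \<rightarrow>\<^sub>E E" using e0 by (auto simp: e_def)
  have q: "norm (q j - p' j) \<le> \<epsilon> * r j" if "j \<in> J" for j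
    using e0[of j] that J(2) by (auto simp: q_def e_def)
  define z where "z = (\<Sum>j\<in>J. \<mu> j *\<^sub>R q j)"
  have zhull: "z \<in> affine hull (q ` J)"
    unfolding z_def using J(1) \<mu>1 hull_subset[of "q ` J" affine]
    by (intro affine_sum_mem affine_affine_hull) auto
  have "norm (z - (p i + u)) = norm (\<Sum>j\<in>J. \<mu> j *\<^sub>R (q j - p' j))"
    by (simp add: z_def flip: p'sum sum_subtractf scaleR_diff_right)
  also have "\<dots> \<le> (\<Sum>j\<in>J. \<epsilon> * v m)"
  proof (rule sum_norm_le)
    fix j assume j: "j \<in> J"
    have "norm (\<mu> j *\<^sub>R (q j - p' j)) \<le> \<bar>\<mu> j\<bar> * (\<epsilon> * r j)"
      using q[OF j] by (simp add: mult_left_mono)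
    also have "\<dots> = \<epsilon> * v j" by (simp add: v_def)
    also have "\<dots> \<le> \<epsilon> * v m" using m(2)[OF j] \<open>0 < \<epsilon>\<close> by simp
    finally show "norm (\<mu> j *\<^sub>R (q j - p' j)) \<le> \<epsilon> * v m" .
  qed
  also have "\<dots> = real (card J) * (\<epsilon> * v m)" by simp
  also have "\<dots> \<le> real (card I) * (\<epsilon> * v m)"
    using J(2) fin vm \<open>0 < \<epsilon>\<close> by (intro mult_right_mono) (auto intro: card_mono)
  also have "\<dots> = t * r i" by (simp add: t(3) N_def)
  finally have err: "norm (z - (p i + u)) \<le> t * r i" .
  \<comment> \<open>\<open>y\<close> solves
    \<open>z = (1 - t) *\<^sub>R p i + t *\<^sub>R y\<close>. Dividing the error by \<open>t\<close>
    leaves at most \<open>r i\<close>, so \<open>y\<close> stays in the inner ball and convexity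
    gives \<open>z\<close>.\<close>
  define y where "y = x i + (1 / t) *\<^sub>R (z - (p i + u))"
  have "norm ((1 / t) *\<^sub>R (z - (p i + u))) \<le> r i"
    using err t(1) by (simp add: divide_le_eq mult.commute)
  then have "y \<in> cball (x i) (r i)" by (simp add: y_def dist_norm)
  then have "y \<in> K i" using K[OF i(1)] by blast
  moreover have "z = (1 - t) *\<^sub>R p i + t *\<^sub>R y"
    using t(1) by (simp add: y_def u_def algebra_simps)
  ultimately have "z \<in> K i"
    using K[OF i(1)] t convexD_alt[of "K i" "p i" y t] by simp
  then show ?thesis
    using i(1) e zhull unfolding q_def J_def by blast
qed

section \<open>Counting selections along one coordinate\<close>

lemma card_PiE_coordinate_le:
  fixes F :: "'i \<Rightarrow> 'b set" and b :: real
  assumes "finite I" "i \<in> I" "\<And>j. j \<in> I \<Longrightarrow> finite (F j)"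
    and b: "\<And>s. s \<in> (\<Pi>\<^sub>E j\<in>I - {i}. F j) \<Longrightarrow> real (card {y \<in> F i. P s y}) \<le> b * real (card (F i))"
  shows "real (card {s \<in> \<Pi>\<^sub>E j\<in>I. F j. P (restrict s (I - {i})) (s i)})
    \<le> b * (\<Prod>j\<in>I. real (card (F j)))"
    (is "real (card ?A) \<le> _")
proof -
  \<comment> \<open>A selection is split into its entries off \<open>i\<close> and its entry at
    \<open>i\<close>; the hypothesis bounds each fibre over the former.\<close>
  define B where "B = (SIGMA s:(\<Pi>\<^sub>E j\<in>I - {i}. F j). {y \<in> F i. P s y})"
  have finP: "finite (\<Pi>\<^sub>E j\<in>I - {i}. F j)" using assms by (intro finite_PiE) auto
  have finB: "finite B" unfolding B_def using finP assms by auto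
  have "card ?A \<le> card B"
  proof (rule card_inj_on_le[OF _ _ finB])
    show "inj_on (\<lambda>s. (restrict s (I - {i}), s i)) ?A"
    proof (rule inj_onI)
      fix s t assume st: "s \<in> ?A" "t \<in> ?A"
        and eq: "(restrict s (I - {i}), s i) = (restrict t (I - {i}), t i)"
      have "s j = t j" if "j \<in> I" for j
      proof (cases "j = i")
        case False
        have "restrict s (I - {i}) j = restrict t (I - {i}) j" using eq by simp
        then show ?thesis using that False by simp
      qed (use eq in simp)
      then show "s = t" using st PiE_ext[of s I F t] by blast
    qed
    show "(\<lambda>s. (restrict s (I - {i}), s i)) ` ?A \<subseteq> B"
    proof clarify
      fix s assume s: "s \<in> Pi\<^sub>E I F" "P (restrict s (I - {i})) (s i)"
      then have "restrict s (I - {i}) \<in> (\<Pi>\<^sub>E j\<in>I - {i}. F j)"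
        by (intro restrict_PiE_iff[THEN iffD2]) auto
      then show "(restrict s (I - {i}), s i) \<in> B"
        unfolding B_def using s assms(2) by auto
    qed
  qed
  then have "real (card ?A) \<le> real (card B)" by simp
  also have "\<dots> = (\<Sum>s\<in>(\<Pi>\<^sub>E j\<in>I - {i}. F j). real (card {y \<in> F i. P s y}))"
    unfolding B_def using finP assms by (subst card_SigmaI) auto
  also have "\<dots> \<le> (\<Sum>s\<in>(\<Pi>\<^sub>E j\<in>I - {i}. F j). b * real (card (F i)))"
    by (rule sum_mono) (rule b)
  also have "\<dots> = b * (real (card (F i)) * (\<Prod>j\<in>I - {i}. real (card (F j))))"
    using assms by (simp add: card_PiE)
  also have "\<dots> = b * (\<Prod>j\<in>I. real (card (F j)))"
    using assms(1,2) by (simp add: prod.remove[of I i])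
  finally show ?thesis .
qed

section \<open>Pigeonhole over the net flats\<close>

theorem theorem2p1:
  fixes \<rho> :: real
  assumes "\<rho> \<ge> 1"
  shows "\<exists>\<beta> :: real \<Rightarrow> real. \<beta> \<in> {0<..1} \<rightarrow> {0<..<1} \<and>
    (\<forall>(k::nat) (\<alpha>::real) (\<F> :: nat \<Rightarrow> (real ^ 'n) set set).
       k \<le> CARD('n) \<longrightarrow>
       \<alpha> \<in> {0<..1} \<longrightarrow>
       (\<forall>j\<in>{1..k+2}. finite (\<F> j) \<and> \<F> j \<noteq> {} \<and> fat_family \<rho> (\<F> j) \<and> (\<forall>K\<in>\<F> j. convex K)) \<longrightarrow>
       real (card {s \<in> colorful_selections (k+2) \<F>. has_transversal k (s ` {1..k+2})})
         \<ge> \<alpha> * (\<Prod>j\<in>{1..k+2}. real (card (\<F> j))) \<longrightarrow>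
       (\<exists>i\<in>{1..k+2}. \<exists>\<G>\<subseteq>\<F> i. real (card \<G>) \<ge> \<beta> \<alpha> * real (card (\<F> i)) \<and> has_transversal k \<G>))"
proof -
  \<comment> \<open>An upper bound for \<open>k + 2\<close> over all admissible \<open>k\<close>, so
    that one \<beta> serves every \<open>k\<close>.\<close>
  define d where "d = CARD('n) + 2"
  define \<epsilon> where "\<epsilon> = 1 / (real d * \<rho>)"
  have \<epsilon>: "0 < \<epsilon>" "real d * \<epsilon> * \<rho> = 1" using assms by (auto simp: \<epsilon>_def d_def)
  obtain E :: "(real ^ 'n) set" where E: "finite E" "cball 0 (2 * \<rho>) \<subseteq> (\<Union>e\<in>E. ball e \<epsilon>)"
    using compact_cball[of "0 :: real ^ 'n" "2 * \<rho>"] \<epsilon>(1) unfolding compact_eq_totally_bounded by blast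
  have "(0 :: real ^ 'n) \<in> cball 0 (2 * \<rho>)" using assms by simp
  then have "E \<noteq> {}" using E(2) by blast
  then have cE: "1 \<le> card E" using E(1) by (simp add: Suc_le_eq card_gt_0_iff)
  \<comment> \<open>Bounds the number of pairs of an index \<open>i\<close> and a choice
    \<open>e\<close> of net points. As \<open>E\<close> is nonempty, replacing the exponent
    \<open>k + 2\<close> by \<open>d\<close> only increases the power.\<close>
  define C where "C = real d * real (card E) ^ d"
  have C: "1 \<le> C"
  proof -
    have "1 * 1 \<le> real d * real (card E) ^ d"
      using cE by (intro mult_mono one_le_power) (auto simp: d_def)
    then show ?thesis by (simp add: C_def)
  qed
  have main: "\<exists>i\<in>{1..k+2}. \<exists>\<G>\<subseteq>\<F> i. real (card \<G>) \<ge> \<alpha> / (2 * C) * real (card (\<F> i)) \<and> has_transversal k \<G>"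
    if k: "k \<le> CARD('n)" and \<alpha>: "\<alpha> \<in> {0<..1}"
      and \<F>: "\<And>j. j \<in> {1..k+2} \<Longrightarrow> finite (\<F> j) \<and> \<F> j \<noteq> {} \<and> fat_family \<rho> (\<F> j) \<and> (\<forall>K\<in>\<F> j. convex K)"
      and many: "real (card {s \<in> colorful_selections (k+2) \<F>. has_transversal k (s ` {1..k+2})})
         \<ge> \<alpha> * (\<Prod>j\<in>{1..k+2}. real (card (\<F> j)))"
    for k :: nat and \<alpha> :: real and \<F> :: "nat \<Rightarrow> (real ^ 'n) set set"
  proof (rule ccontr)
    assume neg: "\<not> ?thesis"
    define I where "I = {1..k+2}"
    have I: "finite I" "card I = k + 2" "card I \<le> d" using k by (auto simp: I_def d_def)
    \<comment> \<open>The factor 2 makes the union bound contradict the lower bound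
      \<open>\<alpha> * Q\<close>, and it keeps \<beta> below 1.\<close>
    define b where "b = \<alpha> / (2 * C)"
    have few: "real (card \<G>) \<le> b * real (card (\<F> i))"
      if "i \<in> I" "\<G> \<subseteq> \<F> i" "has_transversal k \<G>" for i \<G>
      using neg that unfolding I_def b_def by (meson linorder_le_cases)
    \<comment> \<open>Centre and radius are chosen per set, not per family, so overlapping families
      cause no ambiguity.\<close>
    have "\<forall>K\<in>(\<Union>j\<in>I. \<F> j). \<exists>x r. 0 < r \<and> cball x r \<subseteq> K \<and> K \<subseteq> cball x (\<rho> * r)"
    proof
      fix K assume "K \<in> (\<Union>j\<in>I. \<F> j)"
      then obtain x r R where "0 < r" "R \<le> \<rho> * r" "cball x r \<subseteq> K" "K \<subseteq> cball x R"
        using \<F> unfolding I_def fat_family_def by blast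
      then show "\<exists>x r. 0 < r \<and> cball x r \<subseteq> K \<and> K \<subseteq> cball x (\<rho> * r)"
        by (meson subset_cball subset_trans)
    qed
    then obtain x r where xr: "\<And>K. K \<in> (\<Union>j\<in>I. \<F> j) \<Longrightarrow>
        0 < r K \<and> cball (x K) (r K) \<subseteq> K \<and> K \<subseteq> cball (x K) (\<rho> * r K)"
      by metis
    define A where "A i e s = affine hull ((\<lambda>j. x (s j) + r (s j) *\<^sub>R e j) ` (I - {i}))"
      for i :: nat and e :: "nat \<Rightarrow> real ^ 'n" and s :: "nat \<Rightarrow> (real ^ 'n) set"
    \<comment> \<open>The restriction exhibits the flat as a function of the entries off
      \<open>i\<close> alone, as counting along coordinate \<open>i\<close> requires.\<close>
    define H where "H i e = {s \<in> \<Pi>\<^sub>E j\<in>I. \<F> j. s i \<inter> A i e (restrict s (I - {i})) \<noteq> {}}" for i e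
    define Q where "Q = (\<Prod>j\<in>I. real (card (\<F> j)))"
    have "0 < Q" unfolding Q_def
      using \<F> by (intro prod_pos) (auto simp: I_def card_gt_0_iff)
    have H: "real (card (H i e)) \<le> b * Q" if i: "i \<in> I" for i e
      unfolding H_def Q_def
    proof (rule card_PiE_coordinate_le[where P = "\<lambda>s K. K \<inter> A i e s \<noteq> {}"])
      fix s assume "s \<in> (\<Pi>\<^sub>E j\<in>I - {i}. \<F> j)"
      let ?X = "(\<lambda>j. x (s j) + r (s j) *\<^sub>R e j) ` (I - {i})"
      \<comment> \<open>These points may span less than dimension \<open>k\<close>, whereas a
        transversal must have dimension exactly \<open>k\<close>; hence the enlargement to
        \<open>T\<close>, possible since \<open>k \<le> CARD('n)\<close>.\<close>
      have "card ?X \<le> k + 1"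
        using card_image_le[of "I - {i}"] I i
        by (metis Suc_eq_plus1 add_2_eq_Suc' card_Diff_singleton diff_Suc_1 finite_Diff)
      then have "aff_dim ?X \<le> int k" using aff_dim_le_card[of ?X] I(1) by simp
      then obtain T where T: "affine T" "aff_dim T = int k" "?X \<subseteq> T"
        using affine_superset_of_dim[of ?X k] k by auto
      then have "A i e s \<subseteq> T" unfolding A_def by (simp add: hull_minimal)
      then have "\<forall>K\<in>{K \<in> \<F> i. K \<inter> A i e s \<noteq> {}}. K \<inter> T \<noteq> {}" by fast
      then have "has_transversal k {K \<in> \<F> i. K \<inter> A i e s \<noteq> {}}"
        unfolding has_transversal_def flat_def using T by (intro exI[of _ T]) simp
      then show "real (card {K \<in> \<F> i. K \<inter> A i e s \<noteq> {}}) \<le> b * real (card (\<F> i))"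
        using few[OF i, of "{K \<in> \<F> i. K \<inter> A i e s \<noteq> {}}"] by simp
    qed (use I i \<F> in \<open>auto simp: I_def\<close>)
    have finH: "finite (H i e)" for i e
      unfolding H_def using I \<F> by (intro finite_subset[OF _ finite_PiE[of I \<F>]]) (auto simp: I_def)
    \<comment> \<open>Every selection with a transversal is caught by some \<open>H i e\<close>: its
      \<open>k + 2\<close> points on a \<open>k\<close>-flat are dependent, and the perturbation
      lemma applies.\<close>
    have "{s \<in> colorful_selections (k+2) \<F>. has_transversal k (s ` {1..k+2})}
        \<subseteq> (\<Union>(i, e)\<in>I \<times> (I \<rightarrow>\<^sub>E E). H i e)"
    proof
      fix s assume "s \<in> {s \<in> colorful_selections (k+2) \<F>. has_transversal k (s ` {1..k+2})}"
      then obtain T where s: "s \<in> (\<Pi>\<^sub>E j\<in>I. \<F> j)" and T: "aff_dim T = int k" "\<And>j. j \<in> I \<Longrightarrow> s j \<inter> T \<noteq> {}"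
        unfolding colorful_selections_def has_transversal_def flat_def I_def by auto
      define p where "p j = (SOME y. y \<in> s j \<inter> T)" for j
      have p: "p j \<in> s j \<and> p j \<in> T" if "j \<in> I" for j
        using some_in_eq[of "s j \<inter> T"] T(2)[OF that] unfolding p_def by blast
      obtain c :: "nat \<Rightarrow> real" where c: "sum c I = 0" "(\<Sum>i\<in>I. c i *\<^sub>R p i) = 0" "\<exists>i\<in>I. c i \<noteq> 0"
        using indexed_affine_dependence[of I T p] I T(1) p by auto
      have "\<exists>i\<in>I. \<exists>e\<in>I \<rightarrow>\<^sub>E E. s i \<inter> affine hull ((\<lambda>j. x (s j) + r (s j) *\<^sub>R e j) ` (I - {i})) \<noteq> {}"
      proof (rule hit_by_affine_hull_of_net_points[OF I(1) c, where \<rho> = \<rho> and \<epsilon> = \<epsilon>])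
        show "0 < r (s i) \<and> cball (x (s i)) (r (s i)) \<subseteq> s i \<and> s i \<subseteq> cball (x (s i)) (\<rho> * r (s i))
              \<and> convex (s i) \<and> p i \<in> s i" if "i \<in> I" for i
        proof -
          have "s i \<in> \<F> i" using s that by auto
          then show ?thesis using xr[of "s i"] that p[OF that] \<F>[of i] unfolding I_def by blast
        qed
        show "cball 0 (2 * \<rho>) \<subseteq> (\<Union>e\<in>E. cball e \<epsilon>)"
          using E(2) by (meson SUP_mono' ball_subset_cball order_trans)
        have "real (card I) * \<epsilon> * \<rho> \<le> real d * \<epsilon> * \<rho>"
          using I(3) \<epsilon>(1) assms by (intro mult_right_mono) auto
        then show "real (card I) * \<epsilon> * \<rho> \<le> 1" using \<epsilon>(2) by simp
      qed (use assms \<epsilon> in auto)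
      then obtain i e where ie: "i \<in> I" "e \<in> I \<rightarrow>\<^sub>E E"
        "s i \<inter> affine hull ((\<lambda>j. x (s j) + r (s j) *\<^sub>R e j) ` (I - {i})) \<noteq> {}"
        by blast
      moreover have "A i e (restrict s (I - {i})) = affine hull ((\<lambda>j. x (s j) + r (s j) *\<^sub>R e j) ` (I - {i}))"
        unfolding A_def by (intro arg_cong[where f = "\<lambda>X. affine hull X"] image_cong) auto
      ultimately have "s \<in> H i e" using s by (simp add: H_def)
      then show "s \<in> (\<Union>(i, e)\<in>I \<times> (I \<rightarrow>\<^sub>E E). H i e)" using ie by blast
    qed
    moreover have finIE: "finite (I \<times> (I \<rightarrow>\<^sub>E E))" using I(1) E(1) by (simp add: finite_PiE)
    ultimately have "card {s \<in> colorful_selections (k+2) \<F>. has_transversal k (s ` {1..k+2})}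
        \<le> card (\<Union>(i, e)\<in>I \<times> (I \<rightarrow>\<^sub>E E). H i e)"
      using finH by (intro card_mono) auto
    also have "\<dots> \<le> (\<Sum>(i, e)\<in>I \<times> (I \<rightarrow>\<^sub>E E). card (H i e))"
      using card_UN_le[OF finIE, of "\<lambda>(i, e). H i e"] by (simp add: case_prod_unfold)
    finally have "\<alpha> * Q \<le> real (\<Sum>(i, e)\<in>I \<times> (I \<rightarrow>\<^sub>E E). card (H i e))"
      using many unfolding Q_def I_def by linarith
    also have "\<dots> \<le> (\<Sum>(i, e)\<in>I \<times> (I \<rightarrow>\<^sub>E E). b * Q)"
      unfolding of_nat_sum by (rule sum_mono) (use H in auto)
    also have "\<dots> = real (card I) * real (card E) ^ card I * (b * Q)"
      using I(1) by (simp add: card_cartesian_product card_PiE)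
    also have "\<dots> \<le> C * (b * Q)"
    proof (rule mult_right_mono)
      show "real (card I) * real (card E) ^ card I \<le> C"
        unfolding C_def using I(3) cE by (intro mult_mono power_increasing) auto
      show "0 \<le> b * Q" using \<open>0 < Q\<close> C \<alpha> by (simp add: b_def)
    qed
    also have "\<dots> = \<alpha> * Q / 2" using C by (simp add: b_def)
    finally have "\<alpha> * Q \<le> \<alpha> * Q / 2" .
    moreover have "0 < \<alpha> * Q" using \<open>0 < Q\<close> \<alpha> by (intro mult_pos_pos) auto
    ultimately show False by linarith
  qed
  have "(\<lambda>\<alpha>. \<alpha> / (2 * C)) \<in> {0<..1} \<rightarrow> {0<..<1}"
    using C by (auto simp: divide_less_eq)
  then show ?thesis
    using main by (intro exI[of _ "\<lambda>\<alpha>. \<alpha> / (2 * C)"] conjI allI impI) simp_all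
qed

end
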